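(* For every real number $a$, every positive integer $m$ and every integer $n\ge 0$, $$\int_{-1}^{0}\widetilde{F}_{m,a}(n;mx)\,dx=m^nB_n\left(\frac{-a}{m}\right).$$
   Context: For a real number $a$, a positive integer $m$ and integers $n,k\ge 0$, the noncentral Whitney numbers of the second kind are given by $$\widetilde{W}_{m,a}(n,k)=\frac{1}{m^k k!}\sum_{j=0}^{k}\binom{k}{j}(-1)^{k-j}(mj-a)^n,$$ with the convention $0^0=1$. The noncentral Tanny-Dowling polynomials are $$\widetilde{F}_{m,a}(n;x)=\sum_{k=0}^{n}k!\,\widetilde{W}_{m,a}(n,k)\,x^k.$$ $B_n(t)$ denotes the $n$-th Bernoulli polynomial, defined by $\sum_{n=0}^{\infty}B_n(t)\frac{z^n}{n!}=\frac{z e^{tz}}{e^z-1}$. *)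

theory Defs
  imports "HOL-Analysis.Analysis" "HOL-Computational_Algebra.Formal_Power_Series"
begin

definition noncentral_whitney2 :: "nat \<Rightarrow> real \<Rightarrow> nat \<Rightarrow> nat \<Rightarrow> real" where
  "noncentral_whitney2 m a n k =
     1 / (real m ^ k * fact k) *
     (\<Sum>j=0..k. real (k choose j) * (-1) ^ (k - j) * (real m * real j - a) ^ n)"

definition noncentral_tanny_dowling :: "nat \<Rightarrow> real \<Rightarrow> nat \<Rightarrow> real \<Rightarrow> real" where
  "noncentral_tanny_dowling m a n x =
     (\<Sum>k=0..n. fact k * noncentral_whitney2 m a n k * x ^ k)"

(* The quotient z * exp (t * z) / (exp z - 1) is read as one of formal power series in z.
   The denominator has zero constant term, but fps division first cancels the common
   factor z, so the quotient is the exact one: see bernoulli_polynomial_egf. *)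
definition bernoulli_polynomial :: "nat \<Rightarrow> real \<Rightarrow> real" where
  "bernoulli_polynomial n t =
     fact n * fps_nth (fps_X * fps_exp t / (fps_exp 1 - 1)) n"

lemma bernoulli_polynomial_egf:
  "Abs_fps (\<lambda>n. bernoulli_polynomial n t / fact n) * (fps_exp 1 - 1) = fps_X * fps_exp t"
proof -
  have n1: "fps_nth (fps_exp 1 - 1 :: real fps) 1 \<noteq> 0" by simp
  then have nz: "(fps_exp 1 - 1 :: real fps) \<noteq> 0" by (metis fps_zero_nth)
  have "subdegree (fps_exp 1 - 1 :: real fps) \<le> 1"
    using n1 by (rule subdegree_leI)
  also have "1 \<le> subdegree (fps_X * fps_exp t)"
    by (rule subdegree_geI) (auto simp: fps_eq_iff intro: exI[of _ 1])
  finally have "(fps_exp 1 - 1) dvd (fps_X * fps_exp t)"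
    using nz by (subst fps_dvd_iff) auto
  moreover have "Abs_fps (\<lambda>n. bernoulli_polynomial n t / fact n)
      = fps_X * fps_exp t / (fps_exp 1 - 1)"
    by (simp add: fps_eq_iff bernoulli_polynomial_def)
  ultimately show ?thesis by simp
qed

end

theory Submission
  imports Defs
begin

text \<open>
  With \<open>t = - a / m\<close>, integrating termwise turns the left-hand side into \<open>m ^ n\<close> times
  \<open>\<Sum>k\<le>n. (-1)^k / (k + 1) * \<Delta>^k x^n\<close> taken at \<open>x = t\<close>, where the finite difference is \<open>n!\<close> times
  the \<open>n\<close>-th coefficient of \<open>(exp z - 1)^k * exp (t z)\<close>. On the other side,
  \<open>z = ln (1 + (exp z - 1))\<close>; expanding the logarithm and dividing by \<open>exp z - 1\<close> gives
  \<open>z * exp (t z) / (exp z - 1) = (\<Sum>k. (-1)^k / (k + 1) * (exp z - 1)^k) * exp (t z)\<close>.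
\<close>

text \<open>Binomial theorem, using that \<open>fps_exp 1 ^ j\<close> is
  \<open>fps_exp (of_nat j)\<close>. Reading off coefficients then yields finite differences at
  \<open>t\<close>.\<close>

lemma fps_exp_minus_1_power_mult_exp:
  fixes t :: "'a::field_char_0"
  shows "(fps_exp 1 - 1) ^ k * fps_exp t =
    (\<Sum>j\<le>k. fps_const (of_nat (k choose j) * (-1) ^ (k - j)) * fps_exp (of_nat j + t))"
proof -
  have "(fps_exp 1 - 1 :: 'a fps) ^ k = (fps_exp 1 + fps_const (-1)) ^ k"
    by (simp flip: fps_const_neg)
  also have "\<dots> = (\<Sum>j\<le>k. of_nat (k choose j) * fps_exp 1 ^ j * fps_const (-1) ^ (k - j))"
    by (rule binomial_ring)
  also have "\<dots> = (\<Sum>j\<le>k. fps_const (of_nat (k choose j) * (-1) ^ (k - j)) * fps_exp (of_nat j))"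
    by (intro sum.cong refl)
      (simp add: fps_exp_power_mult fps_const_power mult_ac
        flip: fps_const_mult fps_of_nat del: fps_const_neg)
  finally show ?thesis
    by (simp add: sum_distrib_right fps_exp_add_mult mult.assoc)
qed

text \<open>\<open>fps_ln 1\<close> is the compositional inverse of \<open>fps_exp 1 - 1\<close>.
  Splitting \<open>fps_X\<close> off the logarithm series before composing produces the explicit
  factor \<open>fps_exp 1 - 1\<close>.\<close>

lemma fps_X_eq_ln_compose:
  "(fps_X :: 'a::field_char_0 fps) =
    (fps_exp 1 - 1) * (Abs_fps (\<lambda>k. (-1) ^ k / of_nat (Suc k)) oo (fps_exp 1 - 1))"
proof -
  let ?E = "fps_exp 1 - 1 :: 'a fps"
  let ?H = "Abs_fps (\<lambda>k. (-1) ^ k / of_nat (Suc k)) :: 'a fps"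
  have ln: "fps_ln 1 = fps_X * ?H"
    by (rule fps_ext) (auto simp: fps_ln_def field_simps split: nat.split)
  have "fps_X = fps_ln 1 oo ?E"
    using fps_inv[of ?E] by (simp add: fps_ln_fps_exp_inv)
  also have "\<dots> = (fps_X oo ?E) * (?H oo ?E)"
    unfolding ln by (rule fps_compose_mult_distrib) simp
  finally show ?thesis by simp
qed

lemma fps_compose_mult_nth:
  fixes h e g :: "'a::field fps"
  assumes "fps_nth e 0 = 0"
  shows "fps_nth ((h oo e) * g) n = (\<Sum>k\<le>n. fps_nth h k * fps_nth (e ^ k * g) n)"
proof -
  \<comment> \<open>As \<open>e\<close> has no constant term, \<open>e ^ k\<close> has no
    coefficients below \<open>k\<close>. So the range of \<open>k\<close> can be extended from
    \<open>i\<close> to \<open>n\<close>, which makes it independent of \<open>i\<close> and lets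
    the two sums be swapped.\<close>
  have "fps_nth (h oo e) i = (\<Sum>k\<le>n. fps_nth h k * fps_nth (e ^ k) i)" if "i \<le> n" for i
    unfolding fps_compose_nth
    by (rule sum.mono_neutral_left) (use assms that startsby_zero_power_prefix[OF assms] in auto)
  then have "fps_nth ((h oo e) * g) n =
      (\<Sum>i=0..n. (\<Sum>k\<le>n. fps_nth h k * fps_nth (e ^ k) i) * fps_nth g (n - i))"
    by (simp add: fps_mult_nth)
  also have "\<dots> = (\<Sum>k\<le>n. \<Sum>i=0..n. fps_nth h k * fps_nth (e ^ k) i * fps_nth g (n - i))"
    by (simp add: sum_distrib_right) (rule sum.swap)
  finally show ?thesis
    by (simp add: fps_mult_nth sum_distrib_left mult.assoc)
qed

lemma bernoulli_polynomial_eq_sum_differences: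
  "bernoulli_polynomial n t =
    (\<Sum>k\<le>n. (-1) ^ k / real (Suc k) *
      (\<Sum>j\<le>k. real (k choose j) * (-1) ^ (k - j) * (real j + t) ^ n))"
proof -
  let ?E = "fps_exp 1 - 1 :: real fps"
  let ?H = "Abs_fps (\<lambda>k. (-1) ^ k / real (Suc k))"
  have diff: "fact n * fps_nth (?E ^ k * fps_exp t) n =
      (\<Sum>j\<le>k. real (k choose j) * (-1) ^ (k - j) * (real j + t) ^ n)" for k
    by (simp add: fps_exp_minus_1_power_mult_exp fps_sum_nth sum_distrib_left)
  have "fps_nth ?E 1 \<noteq> 0" by simp
  then have nz: "?E \<noteq> 0" by (metis fps_zero_nth)
  \<comment> \<open>\<open>?E\<close> is not a unit, so it has to appear as a factor of the
    numerator before it can be cancelled.\<close>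
  have "fps_X * fps_exp t / ?E = ?E * ((?H oo ?E) * fps_exp t) / ?E"
    by (subst fps_X_eq_ln_compose) (simp add: mult.assoc)
  also have "\<dots> = (?H oo ?E) * fps_exp t"
    using nz by (rule nonzero_mult_div_cancel_left)
  finally have "bernoulli_polynomial n t = fact n * fps_nth ((?H oo ?E) * fps_exp t) n"
    by (simp add: bernoulli_polynomial_def)
  also have "\<dots> = (\<Sum>k\<le>n. (-1) ^ k / real (Suc k) * (fact n * fps_nth (?E ^ k * fps_exp t) n))"
    by (subst fps_compose_mult_nth) (simp_all add: sum_distrib_left mult_ac)
  finally show ?thesis unfolding diff .
qed

lemma integral_power_minus_1_0:
  "((\<lambda>x::real. x ^ k) has_integral (-1) ^ k / real (Suc k)) {-1..0}"
proof -
  have "((\<lambda>x. x ^ Suc k / real (Suc k)) has_vector_derivative x ^ k) (at x within S)"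
    for x :: real and S
    using DERIV_cdivide[OF DERIV_pow[of "Suc k" x S], of "real (Suc k)"]
    by (simp add: has_real_derivative_iff_has_vector_derivative del: of_nat_Suc power_Suc)
  \<comment> \<open>The exponent \<open>Suc k\<close> is positive, so the antiderivative vanishes at
    0 even for \<open>k = 0\<close>.\<close>
  then have "((\<lambda>x::real. x ^ k) has_integral
      0 ^ Suc k / real (Suc k) - (-1) ^ Suc k / real (Suc k)) {-1..0}"
    by (intro fundamental_theorem_of_calculus) simp_all
  then show ?thesis by simp
qed

theorem theorem1:
  fixes a :: real and m n :: nat
  assumes "m > 0"
  shows "integral {-1..0} (\<lambda>x::real. noncentral_tanny_dowling m a n (real m * x))
       = real m ^ n * bernoulli_polynomial n (- a / real m)"
proof -
  let ?c = "\<lambda>k. fact k * noncentral_whitney2 m a n k * real m ^ k"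
  let ?d = "\<lambda>k. \<Sum>j\<le>k. real (k choose j) * (-1) ^ (k - j) * (real j + - a / real m) ^ n"
  \<comment> \<open>The factors \<open>fact k\<close> and \<open>real m ^ k\<close>, the latter
    coming from the argument \<open>real m * x\<close>, cancel the normalisation of
    \<open>noncentral_whitney2\<close>; each \<open>n\<close>-th power then releases a factor
    \<open>real m ^ n\<close>.\<close>
  have c: "?c k = real m ^ n * ?d k" for k
  proof -
    have "(real m * real j - a) ^ n = real m ^ n * (real j + - a / real m) ^ n" for j
      using assms by (simp add: field_simps flip: power_mult_distrib)
    then show ?thesis
      using assms
      by (simp add: noncentral_whitney2_def sum_distrib_left mult_ac atLeast0AtMost)
  qed
  have "((\<lambda>x. \<Sum>k\<le>n. ?c k * x ^ k) has_integral (\<Sum>k\<le>n. ?c k * ((-1) ^ k / real (Suc k)))) {-1..0}"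
    by (intro has_integral_sum has_integral_mult_right integral_power_minus_1_0) simp
  then have "integral {-1..0} (\<lambda>x. noncentral_tanny_dowling m a n (real m * x)) =
      (\<Sum>k\<le>n. ?c k * ((-1) ^ k / real (Suc k)))"
    by (simp add: noncentral_tanny_dowling_def power_mult_distrib mult.assoc atLeast0AtMost
        integral_unique)
  also have "\<dots> = real m ^ n * bernoulli_polynomial n (- a / real m)"
    unfolding c bernoulli_polynomial_eq_sum_differences
    by (simp add: sum_distrib_left mult_ac)
  finally show ?thesis .
qed

end
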